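(* Assume that $\mathcal{X}$ is convex, that $F$ is $\mu$-strongly convex with $\mu>0$, that $G(\cdot,y)$ is linear for every $y\in\mathcal{Y}$ (so $G(x,y)=x^\top a(y)$), and that there exists $\hat{x}\in\mathcal{X}$ such that $\hat{x}^\top a(y)<0$ for all $y\in\mathcal{Y}$. Let $z^*$ be an optimal solution of the dual problem $\sup_{z\in\mathcal{K}}\theta(z)$, and let $\tau=\inf\{t\ge 0 : z^*\in t\,\mathsf{conv}(\mathcal{M})\}$ and $R=\sup_{z\in\mathcal{M}}\lVert z\rVert$. If the cutting-planes (CP) algorithm with a $\delta$-oracle, $\delta\in[0,1)$, and tolerance $\epsilon\ge 0$ executes iteration $k$, for $k\ge 2$, then $$\min_{0\le\ell\le k}\phi(x^\ell)\le\frac{27R^2\tau}{4\mu(1-\delta)^2}\,\frac{1}{k+2}.$$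
   Context: Setting. $m,n$ are positive integers, $F:\mathbb{R}^m\to\mathbb{R}$ and $G:\mathbb{R}^m\times\mathbb{R}^n\to\mathbb{R}$ are continuous, $\mathcal{X}\subset\mathbb{R}^m$ and $\mathcal{Y}\subset\mathbb{R}^n$ are non-empty and compact. The semi-infinite program (SIP) is $\min_{x\in\mathcal{X}}F(x)$ s.t. $G(x,y)\le 0$ for all $y\in\mathcal{Y}$, and $\phi(x)=\max_{y\in\mathcal{Y}}G(x,y)$. When $G(\cdot,y)$ is linear for each $y$, $a(y)\in\mathbb{R}^m$ is defined by $G(x,y)=x^\top a(y)$ (so $a$ is continuous), $\mathcal{M}=\{a(y):y\in\mathcal{Y}\}$ (compact), and $\mathcal{K}=\mathsf{cone}(\mathcal{M})$. Here $\mathsf{conv}$ denotes the convex hull and $\mathsf{cone}$ the generated convex cone (all finite nonnegative combinations; $\mathsf{conv}(\emptyset)=\emptyset$, $\mathsf{cone}(\emptyset)=\{0\}$). The norm is Euclidean. Let $\mathcal{L}(x,z)=F(x)+x^\top z$ and $\theta(z)=\min_{x\in\mathcal{X}}\mathcal{L}(x,z)$; the dual problem is $\sup_{z\in\mathcal{K}}\theta(z)$, which admits an optimal solution under the assumptions of the claim. $\delta$-oracle ($\delta\in[0,1)$): for every $x\in\mathcal{X}$ it returns $\hat{y}(x)\in\mathcal{Y}$ and $\hat{v}(x)\ge\phi(x)$ with $\hat{v}(x)-G(x,\hat{y}(x))\le\delta|\phi(x)|$. CP algorithm (input: a $\delta$-oracle, a tolerance $\epsilon\ge 0$). Start with $\mathcal{M}^0=\emptyset$.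 Iteration $k=0,1,2,\dots$ is: (1) compute an optimal solution $x^k$ of $\min_{x\in\mathcal{X}}F(x)$ s.t. $x^\top z\le 0$ for all $z\in\mathcal{M}^k$, and compute $z^k=\sum_{z\in\mathcal{M}^k}\lambda^k_z z$, where $\lambda^k_z\ge 0$ are Lagrange multipliers of these constraints, i.e. $z^k$ is an optimal solution of $\max_{z\in\mathsf{cone}(\mathcal{M}^k)}\theta(z)$ and the $\lambda_z^k$ are the coefficients of a decomposition of $z^k$ as a conic combination of elements of $\mathcal{M}^k$; (2) call the oracle at $x^k$ to get $y^k=\hat{y}(x^k)$ and set $\xi^k=a(y^k)\in\mathcal{M}$; (3) set $\mathcal{M}^{k+1}=\mathcal{B}^k\cup\{\xi^k\}$, where $\mathcal{B}^k$ is any finite subset of $\mathsf{conv}(\mathcal{M}^k)$ such that $z^k\in\mathsf{cone}(\mathcal{B}^k)$; (4) if $(\xi^k)^\top x^k\le\epsilon$ stop, otherwise proceed to iteration $k+1$. *)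

theory Defs
  imports "HOL-Analysis.Analysis"
begin

definition strongly_convex_on :: "'a::real_normed_vector set \<Rightarrow> real \<Rightarrow> ('a \<Rightarrow> real) \<Rightarrow> bool" where
  "strongly_convex_on S \<mu> f \<longleftrightarrow> convex S \<and>
     (\<forall>x\<in>S. \<forall>y\<in>S. \<forall>u\<ge>0. \<forall>v\<ge>0. u + v = 1 \<longrightarrow>
        f (u *\<^sub>R x + v *\<^sub>R y) \<le> u * f x + v * f y - \<mu> / 2 * u * v * (norm (x - y))\<^sup>2)"

text \<open>
  The suprema and infima in \<open>sip_phi\<close> and \<open>dual_fun\<close> are taken in the reals; they are attained
  when the functions are continuous and the sets are compact and non-empty.
\<close>

definition sip_phi :: "('a \<Rightarrow> 'b \<Rightarrow> real) \<Rightarrow> 'b set \<Rightarrow> 'a \<Rightarrow> real" where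
  "sip_phi G Y x = (SUP y\<in>Y. G x y)"

definition lagrangian :: "('a::real_inner \<Rightarrow> real) \<Rightarrow> 'a \<Rightarrow> 'a \<Rightarrow> real" where
  "lagrangian F x z = F x + x \<bullet> z"

definition dual_fun :: "('a::real_inner \<Rightarrow> real) \<Rightarrow> 'a set \<Rightarrow> 'a \<Rightarrow> real" where
  "dual_fun F X z = (INF x\<in>X. lagrangian F x z)"

definition delta_oracle ::
  "real \<Rightarrow> 'a set \<Rightarrow> 'b set \<Rightarrow> ('a \<Rightarrow> 'b \<Rightarrow> real) \<Rightarrow> ('a \<Rightarrow> 'b) \<Rightarrow> ('a \<Rightarrow> real) \<Rightarrow> bool" where
  "delta_oracle \<delta> X Y G yhat vhat \<longleftrightarrow>
     (\<forall>x\<in>X. yhat x \<in> Y \<and> vhat x \<ge> sip_phi G Y x \<and>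
        vhat x - G x (yhat x) \<le> \<delta> * \<bar>sip_phi G Y x\<bar>)"

text \<open>
  One iteration started from the finite set \<open>M\<close> of cuts, with primal solution \<open>x\<close>, dual solution
  \<open>z\<close> having multipliers \<open>lam\<close>, oracle answer \<open>y\<close>, new cut \<open>xi\<close>, retained set \<open>B\<close> and updated
  set \<open>M'\<close>; the stopping test is not part of it. The convex cone hull of the empty set is \<open>{0}\<close>.
\<close>

definition cp_iteration ::
  "('a::real_inner \<Rightarrow> real) \<Rightarrow> 'a set \<Rightarrow> ('b \<Rightarrow> 'a) \<Rightarrow> ('a \<Rightarrow> 'b) \<Rightarrow>
   'a set \<Rightarrow> 'a \<Rightarrow> 'a \<Rightarrow> ('a \<Rightarrow> real) \<Rightarrow> 'b \<Rightarrow> 'a \<Rightarrow> 'a set \<Rightarrow> 'a set \<Rightarrow> bool" where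
  "cp_iteration F X a yhat M x z lam y xi B M' \<longleftrightarrow>
     is_arg_min F (\<lambda>u. u \<in> X \<and> (\<forall>w\<in>M. u \<bullet> w \<le> 0)) x \<and>
     is_arg_max (dual_fun F X) (\<lambda>w. w \<in> convex_cone hull M) z \<and>
     (\<forall>w\<in>M. lam w \<ge> 0) \<and> z = (\<Sum>w\<in>M. lam w *\<^sub>R w) \<and>
     y = yhat x \<and> xi = a y \<and>
     finite B \<and> B \<subseteq> convex hull M \<and> z \<in> convex_cone hull B \<and>
     M' = B \<union> {xi}"

text \<open>
  The sequences record a run that performs iterations \<open>0, \<dots>, k\<close>: it may stop at iteration \<open>k\<close>,
  but at no earlier one. Entries beyond these iterations are unconstrained.
\<close>

definition cp_executes ::
  "('a::real_inner \<Rightarrow> real) \<Rightarrow> 'a set \<Rightarrow> ('b \<Rightarrow> 'a) \<Rightarrow> ('a \<Rightarrow> 'b) \<Rightarrow> real \<Rightarrow> nat \<Rightarrow>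
   (nat \<Rightarrow> 'a set) \<Rightarrow> (nat \<Rightarrow> 'a) \<Rightarrow> (nat \<Rightarrow> 'a) \<Rightarrow> (nat \<Rightarrow> 'a \<Rightarrow> real) \<Rightarrow>
   (nat \<Rightarrow> 'b) \<Rightarrow> (nat \<Rightarrow> 'a) \<Rightarrow> (nat \<Rightarrow> 'a set) \<Rightarrow> bool" where
  "cp_executes F X a yhat \<epsilon> k M x z lam y xi B \<longleftrightarrow>
     M 0 = {} \<and>
     (\<forall>l\<le>k. cp_iteration F X a yhat (M l) (x l) (z l) (lam l) (y l) (xi l) (B l) (M (Suc l))) \<and>
     (\<forall>l<k. \<not> xi l \<bullet> x l \<le> \<epsilon>)"

end

theory Submission
  imports Defs
begin

text \<open>
  The algorithm is a fully corrective Frank--Wolfe method for the dual problem, and the bound is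
  the Frank--Wolfe estimate of the duality gap along the best iterate.

  Strong convexity of \<open>F\<close> makes the dual function \<open>\<theta>\<close> smooth: if \<open>x0\<close> minimises
  \<open>F + \<langle>\<cdot>, z\<rangle>\<close> over \<open>X\<close>, then \<open>x0\<close> is the gradient of \<open>\<theta>\<close> at \<open>z\<close>, in the quantitative form
  \<open>\<theta> z + \<langle>x0, d\<rangle> - \<parallel>d\<parallel>\<^sup>2 / (2\<mu>) \<le> \<theta> (z + d) \<le> \<theta> z + \<langle>x0, d\<rangle>\<close>
  (\<open>dual_fun_add_ge\<close>, \<open>dual_fun_add_le\<close>). Since \<open>z l\<close> maximises \<open>\<theta>\<close> over the cone of the current
  cuts, the gradient there is orthogonal to \<open>z l\<close> and nonpositive on the cuts; hence it is feasible
  for the relaxed primal problem and coincides with \<open>x l\<close> (\<open>relaxed_solution_is_gradient\<close>).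

  Let \<open>D l = \<theta> zstar - \<theta> (z l)\<close> and \<open>\<phi> l = sip_phi G Y (x l)\<close>, and suppose that every \<open>\<phi> l\<close> is
  positive, as otherwise the claim is trivial. Writing \<open>zstar = t v\<close> with \<open>v\<close> in the convex hull
  of the cuts, the upper bound gives \<open>D l \<le> \<langle>x l, zstar\<rangle> \<le> t \<phi> l\<close>, hence
  \<open>D l \<le> \<tau> \<phi> l\<close>. The next cone contains \<open>z l + s \<xi> l\<close> for all \<open>s \<ge> 0\<close>, and the oracle guarantees
  \<open>\<langle>x l, \<xi> l\<rangle> \<ge> (1 - \<delta>) \<phi> l\<close>; optimising the lower bound over \<open>s\<close> gives
  \<open>D (l + 1) \<le> D l - c (\<phi> l)\<^sup>2\<close> with \<open>c = \<mu> (1 - \<delta>)\<^sup>2 / (2 R\<^sup>2)\<close>.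

  These two recursions yield \<open>D l \<le> \<tau>\<^sup>2 / (c (l + 1))\<close>. Summing the decreases over the second half
  of the run, which cannot exceed the gap left after the first half, gives
  \<open>min \<phi> \<le> 2 \<tau> / (c (k + 1))\<close> (\<open>frank_wolfe_gap_rate\<close>), and
  \<open>2 / (k + 1) \<le> 27 / (8 (k + 2))\<close> for \<open>k \<ge> 1\<close>.
\<close>

section \<open>Smoothness of the dual function\<close>

text \<open>
  Compare \<open>x0\<close> with \<open>(1 - t) x0 + t u\<close>: the strong convexity inequality, divided by \<open>t\<close>, gives the
  claim with the factor \<open>1 - t\<close> in the quadratic term, and \<open>t\<close> tends to \<open>0\<close>.
\<close>

lemma lagrangian_quadratic_growth:
  fixes F :: "'a::real_inner \<Rightarrow> real"
  assumes sc: "strongly_convex_on UNIV \<mu> F" and "convex X" and "x0 \<in> X" and "u \<in> X"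
    and opt: "\<And>v. v \<in> X \<Longrightarrow> lagrangian F x0 z \<le> lagrangian F v z"
  shows "lagrangian F x0 z + \<mu> / 2 * (norm (u - x0))\<^sup>2 \<le> lagrangian F u z"
proof -
  define N where "N = \<mu> / 2 * (norm (x0 - u))\<^sup>2"
  define E where "E = lagrangian F u z - lagrangian F x0 z"
  have ineq: "(1 - t) * N \<le> E" if t: "0 < t" "t < 1" for t
  proof -
    let ?v = "(1 - t) *\<^sub>R x0 + t *\<^sub>R u"
    have "?v \<in> X"
      using assms t by (intro convexD) auto
    then have "lagrangian F x0 z \<le> lagrangian F ?v z"
      by (rule opt)
    moreover have "F ?v \<le> (1 - t) * F x0 + t * F u - \<mu> / 2 * (1 - t) * t * (norm (x0 - u))\<^sup>2"
      using sc t unfolding strongly_convex_on_def by auto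
    ultimately have "t * ((1 - t) * N) \<le> t * E"
      by (simp add: lagrangian_def N_def E_def inner_add_left algebra_simps)
    then show ?thesis using t by simp
  qed
  have "((\<lambda>t. (1 - t) * N) \<longlongrightarrow> (1 - 0) * N) (at_right 0)"
    by (intro tendsto_intros)
  moreover have "eventually (\<lambda>t. (1 - t) * N \<le> E) (at_right 0)"
    using ineq by (auto simp: eventually_at_right_field intro!: exI[of _ 1])
  ultimately have "(1 - 0) * N \<le> E"
    by (intro tendsto_upperbound) auto
  then show ?thesis
    by (simp add: N_def E_def norm_minus_commute)
qed

lemma dual_fun_eq:
  assumes "x0 \<in> X" and "\<And>v. v \<in> X \<Longrightarrow> lagrangian F x0 z \<le> lagrangian F v z"
  shows "dual_fun F X z = lagrangian F x0 z"
  unfolding dual_fun_def using assms by (intro cInf_eq_minimum) auto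

lemma lagrangian_minimiser_exists:
  fixes F :: "'a::real_inner \<Rightarrow> real"
  assumes "continuous_on UNIV F" and "compact X" and "X \<noteq> {}"
  obtains x0 where "x0 \<in> X" and "\<And>v. v \<in> X \<Longrightarrow> lagrangian F x0 z \<le> lagrangian F v z"
proof -
  have "continuous_on X (\<lambda>u. lagrangian F u z)"
    unfolding lagrangian_def
    by (intro continuous_intros continuous_on_subset[OF assms(1)]) auto
  from continuous_attains_inf[OF assms(2,3) this] show ?thesis
    using that by blast
qed

text \<open>
  \<open>\<theta>\<close> is an infimum of functions affine in \<open>z\<close>; the one given by \<open>x0\<close> touches it at \<open>z\<close>.
\<close>

lemma dual_fun_add_le:
  fixes F :: "'a::real_inner \<Rightarrow> real"
  assumes "continuous_on UNIV F" and "compact X" and "x0 \<in> X"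
    and opt: "\<And>v. v \<in> X \<Longrightarrow> lagrangian F x0 z \<le> lagrangian F v z"
  shows "dual_fun F X (z + d) \<le> dual_fun F X z + x0 \<bullet> d"
proof -
  obtain x1 where x1: "x1 \<in> X"
      "\<And>v. v \<in> X \<Longrightarrow> lagrangian F x1 (z + d) \<le> lagrangian F v (z + d)"
    using lagrangian_minimiser_exists assms(1-3) by (metis empty_iff)
  have "dual_fun F X (z + d) \<le> lagrangian F x0 (z + d)"
    using dual_fun_eq[OF x1] x1(2) \<open>x0 \<in> X\<close> by simp
  also have "\<dots> = dual_fun F X z + x0 \<bullet> d"
    by (simp add: dual_fun_eq[OF \<open>x0 \<in> X\<close> opt] lagrangian_def inner_add_right)
  finally show ?thesis .
qed

text \<open>
  Moving from \<open>x0\<close> to \<open>u\<close> costs \<open>\<mu>/2 \<parallel>u - x0\<parallel>\<^sup>2\<close> at \<open>z\<close> and gains at most \<open>\<parallel>u - x0\<parallel> \<parallel>d\<parallel>\<close> from the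
  perturbation \<open>d\<close>; the sum is at least \<open>- \<parallel>d\<parallel>\<^sup>2 / (2\<mu>)\<close>, by completing the square.
\<close>

lemma dual_fun_add_ge:
  fixes F :: "'a::real_inner \<Rightarrow> real"
  assumes "strongly_convex_on UNIV \<mu> F" and "\<mu> > 0" and "convex X" and "x0 \<in> X"
    and opt: "\<And>v. v \<in> X \<Longrightarrow> lagrangian F x0 z \<le> lagrangian F v z"
  shows "dual_fun F X z + x0 \<bullet> d - (norm d)\<^sup>2 / (2 * \<mu>) \<le> dual_fun F X (z + d)"
  unfolding dual_fun_def[of F X "z + d"]
proof (rule cINF_greatest)
  show "X \<noteq> {}" using \<open>x0 \<in> X\<close> by auto
next
  fix u assume u: "u \<in> X"
  define w where "w = u - x0"
  have "0 \<le> (norm (\<mu> *\<^sub>R w + d))\<^sup>2 / (2 * \<mu>)"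
    using \<open>\<mu> > 0\<close> by simp
  also have "(norm (\<mu> *\<^sub>R w + d))\<^sup>2 = \<mu>\<^sup>2 * (norm w)\<^sup>2 + 2 * \<mu> * (w \<bullet> d) + (norm d)\<^sup>2"
    unfolding power2_norm_eq_inner
    by (simp add: inner_add_left inner_add_right inner_commute power2_eq_square)
  also have "\<dots> / (2 * \<mu>) = \<mu> / 2 * (norm w)\<^sup>2 + w \<bullet> d + (norm d)\<^sup>2 / (2 * \<mu>)"
    using \<open>\<mu> > 0\<close> by (simp add: add_divide_distrib power2_eq_square)
  finally have "0 \<le> \<mu> / 2 * (norm (u - x0))\<^sup>2 + (u \<bullet> d - x0 \<bullet> d) + (norm d)\<^sup>2 / (2 * \<mu>)"
    by (simp add: w_def inner_diff_left)
  moreover have "lagrangian F x0 z + \<mu> / 2 * (norm (u - x0))\<^sup>2 \<le> lagrangian F u z"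
    using assms u by (intro lagrangian_quadratic_growth) auto
  moreover have "lagrangian F u (z + d) = lagrangian F u z + u \<bullet> d"
    by (simp add: lagrangian_def inner_add_right)
  ultimately show "dual_fun F X z + x0 \<bullet> d - (norm d)\<^sup>2 / (2 * \<mu>) \<le> lagrangian F u (z + d)"
    by (simp add: dual_fun_eq[OF \<open>x0 \<in> X\<close> opt])
qed

section \<open>Optimality conditions for the relaxed problems\<close>

lemma nonpos_of_le_quadratic:
  fixes p q :: real
  assumes "\<And>s. 0 < s \<Longrightarrow> s < 1 \<Longrightarrow> s * p \<le> s\<^sup>2 * q"
  shows "p \<le> 0"
proof -
  have "p \<le> s * q" if "0 < s" "s < 1" for s
    using assms[OF that] that by (simp add: power2_eq_square)
  then have "eventually (\<lambda>s. p \<le> s * q) (at_right 0)"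
    by (auto simp: eventually_at_right_field intro!: exI[of _ 1])
  moreover have "((\<lambda>s. s * q) \<longlongrightarrow> 0 * q) (at_right 0)"
    by (intro tendsto_intros)
  ultimately have "p \<le> 0 * q"
    by (intro tendsto_lowerbound) auto
  then show ?thesis by simp
qed

text \<open>
  First-order conditions at a maximiser \<open>z\<close> over a convex cone \<open>K\<close>: all directions of \<open>K\<close> are
  feasible at \<open>z\<close>, and so is \<open>- z\<close>.
\<close>

lemma dual_maximiser_conditions:
  fixes F :: "'a::real_inner \<Rightarrow> real"
  assumes "strongly_convex_on UNIV \<mu> F" and "\<mu> > 0" and "convex X" and "x0 \<in> X"
    and opt: "\<And>v. v \<in> X \<Longrightarrow> lagrangian F x0 z \<le> lagrangian F v z"
    and K: "convex_cone K" and "z \<in> K"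
    and max: "\<And>w. w \<in> K \<Longrightarrow> dual_fun F X w \<le> dual_fun F X z"
  shows "\<And>w. w \<in> K \<Longrightarrow> x0 \<bullet> w \<le> 0" and "x0 \<bullet> z = 0"
proof -
  have feasible_direction: "x0 \<bullet> w \<le> 0"
    if w: "\<And>s. 0 < s \<Longrightarrow> s < 1 \<Longrightarrow> z + s *\<^sub>R w \<in> K" for w
  proof (rule nonpos_of_le_quadratic)
    fix s :: real assume s: "0 < s" "s < 1"
    have "dual_fun F X z + x0 \<bullet> (s *\<^sub>R w) - (norm (s *\<^sub>R w))\<^sup>2 / (2 * \<mu>) \<le> dual_fun F X (z + s *\<^sub>R w)"
      using assms by (intro dual_fun_add_ge) auto
    also have "\<dots> \<le> dual_fun F X z"
      using w[OF s] by (rule max)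
    finally show "s * (x0 \<bullet> w) \<le> s\<^sup>2 * ((norm w)\<^sup>2 / (2 * \<mu>))"
      by (simp add: power_mult_distrib)
  qed
  show le: "x0 \<bullet> w \<le> 0" if "w \<in> K" for w
    using that \<open>z \<in> K\<close> K by (intro feasible_direction convex_cone_add convex_cone_scaleR) auto
  have "z + s *\<^sub>R (- z) = (1 - s) *\<^sub>R z" for s
    by (simp add: algebra_simps)
  then have "x0 \<bullet> (- z) \<le> 0"
    using \<open>z \<in> K\<close> K by (intro feasible_direction) (simp add: convex_cone_scaleR del: scaleR_minus_right)
  with le[OF \<open>z \<in> K\<close>] show "x0 \<bullet> z = 0"
    by simp
qed

text \<open>
  The minimiser \<open>x0\<close> of the Lagrangian at \<open>z\<close> satisfies the cuts and complementarity. As \<open>x\<close> is at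
  least as good for \<open>F\<close> and \<open>\<langle>x, z\<rangle> \<le> 0\<close>, it also minimises the Lagrangian at \<open>z\<close>, and quadratic
  growth leaves only \<open>x = x0\<close>.
\<close>

lemma relaxed_solution_is_gradient:
  fixes F :: "'a::real_inner \<Rightarrow> real"
  assumes "continuous_on UNIV F" and "strongly_convex_on UNIV \<mu> F" and "\<mu> > 0"
    and "compact X" and "convex X"
    and primal: "is_arg_min F (\<lambda>u. u \<in> X \<and> (\<forall>w\<in>M. u \<bullet> w \<le> 0)) x"
    and dual: "is_arg_max (dual_fun F X) (\<lambda>w. w \<in> convex_cone hull M) z"
  shows "x \<in> X" and "\<And>v. v \<in> X \<Longrightarrow> lagrangian F x z \<le> lagrangian F v z" and "x \<bullet> z = 0"
proof -
  have x: "x \<in> X" "\<And>w. w \<in> M \<Longrightarrow> x \<bullet> w \<le> 0"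
      "\<And>u. u \<in> X \<Longrightarrow> \<forall>w\<in>M. u \<bullet> w \<le> 0 \<Longrightarrow> F x \<le> F u"
    using primal by (auto simp: is_arg_min_linorder)
  have z: "z \<in> convex_cone hull M"
      "\<And>w. w \<in> convex_cone hull M \<Longrightarrow> dual_fun F X w \<le> dual_fun F X z"
    using dual by (auto simp: is_arg_max_linorder)
  obtain x0 where x0: "x0 \<in> X" "\<And>v. v \<in> X \<Longrightarrow> lagrangian F x0 z \<le> lagrangian F v z"
    using lagrangian_minimiser_exists assms(1,4) x(1) by (metis empty_iff)
  note conds = dual_maximiser_conditions[OF assms(2,3,5) x0 convex_cone_convex_cone_hull z]
  have "F x \<le> F x0"
    using x(3)[OF x0(1)] conds(1) by (simp add: hull_inc)
  moreover have "convex_cone hull M \<subseteq> {w. x \<bullet> w \<le> 0}"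
    using x(2) by (intro hull_minimal convex_cone_halfspace_le) auto
  then have "x \<bullet> z \<le> 0"
    using z(1) by auto
  ultimately have "lagrangian F x z \<le> lagrangian F x0 z"
    using conds(2) by (simp add: lagrangian_def)
  moreover have "lagrangian F x0 z + \<mu> / 2 * (norm (x - x0))\<^sup>2 \<le> lagrangian F x z"
    using lagrangian_quadratic_growth[OF assms(2,5) x0(1) x(1) x0(2)] .
  ultimately have "\<mu> / 2 * (norm (x - x0))\<^sup>2 \<le> 0"
    by linarith
  then have "x = x0"
    using \<open>\<mu> > 0\<close> by (simp add: mult_le_0_iff)
  then show "x \<in> X" and "\<And>v. v \<in> X \<Longrightarrow> lagrangian F x z \<le> lagrangian F v z" and "x \<bullet> z = 0"
    using x0 conds(2) by auto
qed

section \<open>The Frank--Wolfe recursion\<close>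

text \<open>
  With \<open>d l \<le> f l\<close>, the decrease \<open>d (l + 1) \<le> d l - (d l)\<^sup>2\<close> implies \<open>d l \<le> 1 / (l + 1)\<close>. From
  \<open>p = k div 2\<close> on, \<open>k - p + 1\<close> decreases of at least \<open>m\<^sup>2\<close> each must fit into \<open>d p \<le> 1 / (p + 1)\<close>, and
  \<open>(p + 1) (k - p + 1) \<ge> ((k + 1) / 2)\<^sup>2\<close>.
\<close>

lemma frank_wolfe_gap_rate_normalised:
  fixes d f :: "nat \<Rightarrow> real"
  assumes df: "\<And>l. l \<le> k \<Longrightarrow> d l \<le> f l"
    and last: "\<And>l. l \<le> k \<Longrightarrow> (f l)\<^sup>2 \<le> d l"
    and dec: "\<And>l. l < k \<Longrightarrow> d (Suc l) \<le> d l - (f l)\<^sup>2"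
    and m: "\<And>l. l \<le> k \<Longrightarrow> m \<le> f l" and "m \<ge> 0"
  shows "m * (real k + 1) \<le> 2"
proof -
  have d0: "0 \<le> d l" if "l \<le> k" for l
    using last[OF that] zero_le_power2[of "f l"] by linarith
  have rate: "l \<le> k \<Longrightarrow> d l * (real l + 1) \<le> 1" for l
  proof (induction l)
    case 0
    have "(f 0)\<^sup>2 \<le> f 0" using df[of 0] last[of 0] by simp
    then have "f 0 \<le> 1" using m[of 0] \<open>m \<ge> 0\<close>
      by (smt (verit) power2_eq_square mult_left_le mult_cancel_left1 mult_less_cancel_left1)
    then show ?case using df[of 0] by simp
  next
    case (Suc l)
    then have IH: "d l * (real l + 1) \<le> 1" and l: "l < k" by auto
    have dl: "0 \<le> d l" using d0 l by simp
    have "d l \<le> 1"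
    proof -
      have "d l * 1 \<le> d l * (real l + 1)" using dl by (intro mult_left_mono) auto
      then show ?thesis using IH by simp
    qed
    have "(d l)\<^sup>2 \<le> (f l)\<^sup>2" using df[of l] dl l by (intro power_mono) auto
    then have "d (Suc l) \<le> d l * (1 - d l)"
      using dec[OF l] by (simp add: power2_eq_square algebra_simps)
    then have "d (Suc l) * (real l + 2) \<le> d l * (1 - d l) * (real l + 2)"
      by (intro mult_right_mono) auto
    also have "\<dots> = (1 - d l) * (d l * (real l + 1) + d l)"
      by (simp add: algebra_simps)
    also have "\<dots> \<le> (1 - d l) * (1 + d l)"
      using IH \<open>d l \<le> 1\<close> by (intro mult_left_mono) auto
    also have "\<dots> \<le> 1"
      by (simp add: algebra_simps)
    finally show ?case by (simp add: algebra_simps)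
  qed
  define p where "p = k div 2"
  have pk: "p \<le> k" by (simp add: p_def)
  have msq: "m\<^sup>2 \<le> (f l)\<^sup>2" if "l \<le> k" for l
    using m[OF that] \<open>m \<ge> 0\<close> by (intro power_mono)
  have tele: "p + j \<le> k \<Longrightarrow> d (p + j) \<le> d p - real j * m\<^sup>2" for j
  proof (induction j)
    case (Suc j)
    then show ?case using dec[of "p + j"] msq[of "p + j"] by (simp add: algebra_simps)
  qed simp
  have "(real (k - p) + 1) * m\<^sup>2 \<le> d p"
    using tele[of "k - p"] last[of k] msq[of k] pk by (simp add: algebra_simps)
  then have "((real (k - p) + 1) * m\<^sup>2) * (real p + 1) \<le> d p * (real p + 1)"
    by (intro mult_right_mono) auto
  also have "\<dots> \<le> 1" using rate pk by simp
  finally have A: "((real (k - p) + 1) * (real p + 1)) * m\<^sup>2 \<le> 1"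
    by (simp add: algebra_simps)
  have "k + 1 \<le> 2 * (p + 1)" and "k + 1 \<le> 2 * (k - p + 1)"
    unfolding p_def by presburger+
  then have "real (k + 1) \<le> real (2 * (p + 1))" and "real (k + 1) \<le> real (2 * (k - p + 1))"
    unfolding of_nat_le_iff .
  then have "(real k + 1) / 2 \<le> real p + 1" and "(real k + 1) / 2 \<le> real (k - p) + 1"
    by simp_all
  then have "(real k + 1) / 2 * ((real k + 1) / 2) \<le> (real (k - p) + 1) * (real p + 1)"
    by (intro mult_mono) auto
  then have "(real k + 1) / 2 * ((real k + 1) / 2) * m\<^sup>2 \<le> 1"
    using A by (meson mult_right_mono order_trans zero_le_power2)
  then have "(m * (real k + 1))\<^sup>2 \<le> 2\<^sup>2"
    by (simp add: power2_eq_square field_simps)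
  then show ?thesis
    by (rule power2_le_imp_le) simp
qed

text \<open>
  The scaling \<open>d = c D / \<tau>\<^sup>2\<close>, \<open>f = c \<phi> / \<tau>\<close> removes the constants. Positivity of \<open>\<tau>\<close> follows from
  \<open>c (\<phi> 0)\<^sup>2 \<le> D 0 \<le> \<tau> \<phi> 0\<close>.
\<close>

lemma frank_wolfe_gap_rate:
  fixes D \<phi> :: "nat \<Rightarrow> real"
  assumes "c > 0" and "m > 0"
    and gap: "\<And>l. l \<le> k \<Longrightarrow> D l \<le> \<tau> * \<phi> l"
    and last: "\<And>l. l \<le> k \<Longrightarrow> c * (\<phi> l)\<^sup>2 \<le> D l"
    and dec: "\<And>l. l < k \<Longrightarrow> D (Suc l) \<le> D l - c * (\<phi> l)\<^sup>2"
    and m: "\<And>l. l \<le> k \<Longrightarrow> m \<le> \<phi> l"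
  shows "m \<le> 2 * \<tau> / (c * (real k + 1))"
proof -
  have "0 < \<phi> 0" using m[of 0] \<open>m > 0\<close> by simp
  moreover have "c * (\<phi> 0)\<^sup>2 \<le> \<tau> * \<phi> 0" using gap[of 0] last[of 0] by simp
  ultimately have "c * \<phi> 0 \<le> \<tau>" by (simp add: power2_eq_square)
  then have \<tau>: "\<tau> > 0" using \<open>c > 0\<close> \<open>0 < \<phi> 0\<close> by (smt (verit) mult_pos_pos)
  define h where "h = c / \<tau>\<^sup>2"
  have h: "0 \<le> h" using \<open>c > 0\<close> by (simp add: h_def)
  have f2: "(c * \<phi> l / \<tau>)\<^sup>2 = h * (c * (\<phi> l)\<^sup>2)" for l
    by (simp add: h_def power2_eq_square)
  have "c * m / \<tau> * (real k + 1) \<le> 2"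
  proof (rule frank_wolfe_gap_rate_normalised[where d = "\<lambda>l. h * D l" and f = "\<lambda>l. c * \<phi> l / \<tau>"])
    fix l assume l: "l \<le> k"
    have "h * D l \<le> h * (\<tau> * \<phi> l)" using gap[OF l] h by (rule mult_left_mono)
    also have "\<dots> = c * \<phi> l / \<tau>" using \<tau> by (simp add: h_def power2_eq_square)
    finally show "h * D l \<le> c * \<phi> l / \<tau>" .
    show "(c * \<phi> l / \<tau>)\<^sup>2 \<le> h * D l"
      unfolding f2 using last[OF l] h by (rule mult_left_mono)
    show "c * m / \<tau> \<le> c * \<phi> l / \<tau>"
      using m[OF l] \<tau> \<open>c > 0\<close> by (simp add: divide_right_mono)
  next
    fix l assume l: "l < k"
    have "h * D (Suc l) \<le> h * (D l - c * (\<phi> l)\<^sup>2)" using dec[OF l] h by (rule mult_left_mono)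
    then show "h * D (Suc l) \<le> h * D l - (c * \<phi> l / \<tau>)\<^sup>2"
      unfolding f2 by (simp add: algebra_simps)
  next
    show "0 \<le> c * m / \<tau>" using \<tau> assms(1,2) by simp
  qed
  then have "m * (c * (real k + 1)) \<le> 2 * \<tau>"
    using \<tau> by (simp add: field_simps)
  then show ?thesis
    using \<open>c > 0\<close> by (subst pos_le_divide_eq) auto
qed

section \<open>Convergence of the cutting-planes algorithm\<close>

text \<open>
  Along the ray spanned by the new cut the smoothness bound is a concave quadratic in the step
  length, with slope \<open>\<langle>x0, \<xi>\<rangle>\<close> at \<open>0\<close>; \<open>g \<mu> / R\<^sup>2\<close> maximises it after \<open>\<langle>x0, \<xi>\<rangle>\<close> and \<open>\<parallel>\<xi>\<parallel>\<close> have been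
  replaced by their bounds.
\<close>

lemma dual_ray_increase:
  fixes F :: "'a::real_inner \<Rightarrow> real"
  assumes "strongly_convex_on UNIV \<mu> F" and "\<mu> > 0" and "convex X" and "x0 \<in> X"
    and "\<And>v. v \<in> X \<Longrightarrow> lagrangian F x0 z \<le> lagrangian F v z"
    and "R > 0" and "norm \<xi> \<le> R" and "0 \<le> g" and "g \<le> x0 \<bullet> \<xi>"
  shows "dual_fun F X z + \<mu> * g\<^sup>2 / (2 * R\<^sup>2) \<le> dual_fun F X (z + (g * \<mu> / R\<^sup>2) *\<^sub>R \<xi>)"
proof -
  define s where "s = g * \<mu> / R\<^sup>2"
  have s: "0 \<le> s" using assms by (simp add: s_def)
  have "\<mu> * g\<^sup>2 / (2 * R\<^sup>2) = s * g - s\<^sup>2 * R\<^sup>2 / (2 * \<mu>)"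
    using \<open>\<mu> > 0\<close> \<open>R > 0\<close> by (simp add: s_def field_simps power2_eq_square)
  also have "\<dots> \<le> s * (x0 \<bullet> \<xi>) - s\<^sup>2 * (norm \<xi>)\<^sup>2 / (2 * \<mu>)"
    using assms s by (intro diff_mono divide_right_mono mult_left_mono power_mono) auto
  also have "\<dots> = x0 \<bullet> (s *\<^sub>R \<xi>) - (norm (s *\<^sub>R \<xi>))\<^sup>2 / (2 * \<mu>)"
    by (simp add: power_mult_distrib)
  finally show ?thesis
    using dual_fun_add_ge[OF assms(1-5), of "s *\<^sub>R \<xi>"] unfolding s_def by simp
qed

text \<open>
  The infimum is the gauge of the convex hull of \<open>A\<close> at \<open>z\<close>. If \<open>z = t v\<close> with \<open>v\<close> in
  the convex hull, then \<open>\<langle>x, z\<rangle> = t \<langle>x, v\<rangle> \<le> t b\<close>; taking the infimum over \<open>t\<close> keeps the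
  inequality, whether or not it is attained.
\<close>

lemma inner_le_gauge_mult:
  fixes A :: "'a::real_inner set"
  assumes "A \<noteq> {}" and z: "z \<in> convex_cone hull A"
    and bound: "\<And>v. v \<in> A \<Longrightarrow> x \<bullet> v \<le> b" and "b > 0"
  shows "x \<bullet> z \<le> Inf {t. t \<ge> 0 \<and> z \<in> (\<lambda>v. t *\<^sub>R v) ` (convex hull A)} * b"
proof -
  let ?T = "{t. t \<ge> 0 \<and> z \<in> (\<lambda>v. t *\<^sub>R v) ` (convex hull A)}"
  have "x \<bullet> z / b \<le> Inf ?T"
  proof (rule cInf_greatest)
    show "?T \<noteq> {}"
      using z \<open>A \<noteq> {}\<close> by (auto simp: convex_cone_hull_convex_hull_nonempty)
    fix t assume "t \<in> ?T"
    then obtain v where t: "t \<ge> 0" and v: "v \<in> convex hull A" "z = t *\<^sub>R v" by auto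
    have "convex hull A \<subseteq> {v. x \<bullet> v \<le> b}"
      using bound by (intro hull_minimal convex_halfspace_le) auto
    then have "t * (x \<bullet> v) \<le> t * b" using v t by (intro mult_left_mono) auto
    then show "x \<bullet> z / b \<le> t" using v \<open>b > 0\<close> by (simp add: field_simps)
  qed
  then show ?thesis using \<open>b > 0\<close> by (simp add: field_simps)
qed

lemma le_sip_phi:
  assumes "compact Y" and "continuous_on UNIV (\<lambda>(u, w). G u w)" and "w \<in> Y"
  shows "G x w \<le> sip_phi G Y x"
proof -
  have "continuous_on Y (\<lambda>w. (\<lambda>(u, w). G u w) (x, w))"
    by (intro continuous_on_compose2[OF assms(2)] continuous_intros) auto
  then have "compact (G x ` Y)"
    using assms(1) by (intro compact_continuous_image) simp_all
  then have "bdd_above (G x ` Y)"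
    by (simp add: bounded_imp_bdd_above compact_imp_bounded)
  then show ?thesis
    unfolding sip_phi_def using assms(3) by (rule cSUP_upper[rotated])
qed

lemma delta_oracle_slope:
  assumes "delta_oracle \<delta> X Y G yhat vhat" and "x \<in> X" and "sip_phi G Y x > 0"
  shows "yhat x \<in> Y" and "(1 - \<delta>) * sip_phi G Y x \<le> G x (yhat x)"
  using assms by (fastforce simp: delta_oracle_def algebra_simps)+

text \<open>
  The coordinates of \<open>a w\<close> are the values \<open>G (axis i 1) w\<close>, so \<open>a\<close> inherits continuity from \<open>G\<close>.
\<close>

lemma bounded_linear_cut_set:
  fixes G :: "real ^ 'm \<Rightarrow> 'b::topological_space \<Rightarrow> real"
  assumes "compact Y" and "continuous_on UNIV (\<lambda>(u, w). G u w)"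
    and Ga: "\<And>u w. w \<in> Y \<Longrightarrow> G u w = u \<bullet> a w"
  shows "bounded (a ` Y)"
proof -
  have "continuous_on Y (\<lambda>w. \<chi> i. (\<lambda>(u, w). G u w) (axis i 1, w))"
    by (intro continuous_on_vec_lambda continuous_on_compose2[OF assms(2)] continuous_intros) auto
  moreover have "(\<chi> i. (\<lambda>(u, w). G u w) (axis i 1, w)) = a w" if "w \<in> Y" for w
    using Ga[OF that] by (simp add: vec_eq_iff inner_axis')
  ultimately have "continuous_on Y a"
    by (simp cong: continuous_on_cong)
  then show ?thesis
    using assms(1) by (intro compact_imp_bounded compact_continuous_image)
qed

text \<open>
  These two facts are all that the convergence proof uses of the cut management: discarding cuts is
  harmless because the cone over the retained set \<open>B l\<close> still contains \<open>z l\<close>, and replacing cuts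
  by convex combinations does not leave the convex hull of the original ones.
\<close>

lemma cp_executes_cuts:
  assumes run: "cp_executes F X a yhat \<epsilon> k M x z lam y xi B"
    and yY: "\<And>l. l \<le> k \<Longrightarrow> yhat (x l) \<in> Y" and "l \<le> k"
  shows "M l \<subseteq> convex hull (a ` Y)"
    and "0 \<le> s \<Longrightarrow> z l + s *\<^sub>R a (yhat (x l)) \<in> convex_cone hull (M (Suc l))"
proof -
  have it: "cp_iteration F X a yhat (M l) (x l) (z l) (lam l) (y l) (xi l) (B l) (M (Suc l))"
    if "l \<le> k" for l
    using run that by (simp add: cp_executes_def)
  show "M l \<subseteq> convex hull (a ` Y)"
    using \<open>l \<le> k\<close>
  proof (induction l)
    case 0
    then show ?case using run by (simp add: cp_executes_def)
  next
    case (Suc l)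
    then have l: "l \<le> k" and IH: "M l \<subseteq> convex hull (a ` Y)" by auto
    have "convex hull (M l) \<subseteq> convex hull (a ` Y)"
      using IH by (intro hull_minimal) auto
    moreover have "a (yhat (x l)) \<in> convex hull (a ` Y)"
      using yY[OF l] by (intro hull_inc) auto
    ultimately show ?case
      using it[OF l] by (auto simp: cp_iteration_def)
  qed
  have M': "M (Suc l) = B l \<union> {a (yhat (x l))}" and zB: "z l \<in> convex_cone hull (B l)"
    using it[OF \<open>l \<le> k\<close>] by (auto simp: cp_iteration_def)
  have "z l \<in> convex_cone hull (M (Suc l))"
    using zB hull_mono[of "B l" "M (Suc l)"] M' by auto
  then show "z l + s *\<^sub>R a (yhat (x l)) \<in> convex_cone hull (M (Suc l))" if "0 \<le> s"
    using that M' by (intro convex_cone_hull_add convex_cone_hull_mul) (auto intro: hull_inc)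
qed

theorem theorem6:
  fixes F :: "real ^ 'm \<Rightarrow> real"
    and G :: "real ^ 'm \<Rightarrow> real ^ 'n \<Rightarrow> real"
    and X :: "(real ^ 'm) set" and Y :: "(real ^ 'n) set"
    and a :: "real ^ 'n \<Rightarrow> real ^ 'm"
    and \<mu> \<delta> \<epsilon> \<tau> R :: real and k :: nat
    and zstar :: "real ^ 'm"
    and yhat :: "real ^ 'm \<Rightarrow> real ^ 'n" and vhat :: "real ^ 'm \<Rightarrow> real"
    and M B :: "nat \<Rightarrow> (real ^ 'm) set"
    and x z xi :: "nat \<Rightarrow> real ^ 'm" and lam :: "nat \<Rightarrow> real ^ 'm \<Rightarrow> real"
    and y :: "nat \<Rightarrow> real ^ 'n"
  assumes "continuous_on UNIV F"
    and "continuous_on UNIV (\<lambda>(u, w). G u w)"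
    and "compact X" and "X \<noteq> {}"
    and "compact Y" and "Y \<noteq> {}"
    and "convex X"
    and "\<mu> > 0" and "strongly_convex_on UNIV \<mu> F"
    and "\<And>w. w \<in> Y \<Longrightarrow> linear (\<lambda>u. G u w)"
    and "\<And>u w. w \<in> Y \<Longrightarrow> G u w = u \<bullet> a w"
    and "\<exists>xhat\<in>X. \<forall>w\<in>Y. xhat \<bullet> a w < 0"
    and "is_arg_max (dual_fun F X) (\<lambda>v. v \<in> convex_cone hull (a ` Y)) zstar"
    and "\<tau> = Inf {t. t \<ge> 0 \<and> zstar \<in> (\<lambda>v. t *\<^sub>R v) ` (convex hull (a ` Y))}"
    and "R = (SUP v\<in>a ` Y. norm v)"
    and "0 \<le> \<delta>" and "\<delta> < 1" and "\<epsilon> \<ge> 0"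
    and "delta_oracle \<delta> X Y G yhat vhat"
    and "k \<ge> 2"
    and "cp_executes F X a yhat \<epsilon> k M x z lam y xi B"
  shows "(MIN l\<in>{0..k}. sip_phi G Y (x l))
           \<le> 27 * R\<^sup>2 * \<tau> / (4 * \<mu> * (1 - \<delta>)\<^sup>2) * (1 / (real k + 2))"
proof -
  note cF = assms(1) and cG = assms(2) and compX = assms(3) and compY = assms(5)
    and Y = assms(6) and convX = assms(7) and \<mu> = assms(8) and sc = assms(9) and Ga = assms(11)
    and zs = assms(13) and yhat_oracle = assms(19) and run = assms(21)
  define \<phi> where "\<phi> l = sip_phi G Y (x l)" for l
  define m where "m = (MIN l\<in>{0..k}. \<phi> l)"
  have m: "m \<le> \<phi> l" if "l \<le> k" for l
    unfolding m_def using that by (intro Min_le) auto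
  have bdd: "bdd_above (norm ` a ` Y)"
    using bounded_linear_cut_set[OF compY cG Ga] by (auto simp: bdd_above_norm)
  have R: "norm (a w) \<le> R" if "w \<in> Y" for w
    unfolding assms(15) using that by (intro cSUP_upper bdd) auto
  have zsK: "zstar \<in> convex_cone hull (a ` Y)"
    and zsmax: "\<And>w. w \<in> convex_cone hull (a ` Y) \<Longrightarrow> dual_fun F X w \<le> dual_fun F X zstar"
    using zs by (auto simp: is_arg_max_linorder)
  have \<tau>0: "0 \<le> \<tau>"
    unfolding assms(14) using zsK Y
    by (intro cInf_greatest) (auto simp: convex_cone_hull_convex_hull_nonempty)
  show ?thesis
  proof (cases "m \<le> 0")
    case True
    have "0 \<le> 27 * R\<^sup>2 * \<tau> / (4 * \<mu> * (1 - \<delta>)\<^sup>2) * (1 / (real k + 2))"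
      using \<tau>0 \<mu> by simp
    with True show ?thesis unfolding m_def \<phi>_def by linarith
  next
    case False
    then have mpos: "m > 0" by simp
    have \<phi>pos: "\<phi> l > 0" if "l \<le> k" for l
      using m[OF that] mpos by simp
    have prim: "is_arg_min F (\<lambda>u. u \<in> X \<and> (\<forall>w\<in>M l. u \<bullet> w \<le> 0)) (x l)"
      and dual: "is_arg_max (dual_fun F X) (\<lambda>w. w \<in> convex_cone hull (M l)) (z l)"
      if "l \<le> k" for l
      using run that by (auto simp: cp_executes_def cp_iteration_def)
    note grad = relaxed_solution_is_gradient[OF cF sc \<mu> compX convX prim dual]
    have yY: "yhat (x l) \<in> Y" and slope: "(1 - \<delta>) * \<phi> l \<le> x l \<bullet> a (yhat (x l))" if "l \<le> k" for l
      using delta_oracle_slope[OF yhat_oracle grad(1)] \<phi>pos that Ga unfolding \<phi>_def by auto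
    note cuts = cp_executes_cuts[OF run yY]
    (* The value of a zero cut is 0, while the cut returned at x 0 has a positive value there. *)
    have Rpos: "R > 0"
    proof -
      have "0 < (1 - \<delta>) * \<phi> 0" using \<phi>pos[of 0] assms(17) by simp
      then have "a (yhat (x 0)) \<noteq> 0" using slope[of 0] by auto
      then show ?thesis using R[OF yY[of 0]] by (smt (verit) zero_less_norm_iff zero_le)
    qed
    have coneY: "convex_cone hull (M l) \<subseteq> convex_cone hull (a ` Y)" if "l \<le> k" for l
    proof (intro hull_minimal convex_cone_convex_cone_hull)
      show "M l \<subseteq> convex_cone hull (a ` Y)"
        using cuts(1)[OF _ that] by (auto simp: convex_cone_hull_separate hull_inc)
    qed
    define D where "D l = dual_fun F X zstar - dual_fun F X (z l)" for l
    define c where "c = \<mu> * (1 - \<delta>)\<^sup>2 / (2 * R\<^sup>2)"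
    define s where "s l = (1 - \<delta>) * \<phi> l * \<mu> / R\<^sup>2" for l
    have incr: "dual_fun F X (z l) + c * (\<phi> l)\<^sup>2 \<le> dual_fun F X (z l + s l *\<^sub>R a (yhat (x l)))"
      if "l \<le> k" for l
    proof -
      have "0 \<le> (1 - \<delta>) * \<phi> l" using \<phi>pos[OF that] assms(17) by simp
      from dual_ray_increase[OF sc \<mu> convX grad(1,2)[OF that that] Rpos R[OF yY[OF that]] this
          slope[OF that]]
      show ?thesis by (simp add: c_def s_def power_mult_distrib mult.assoc)
    qed
    have s0: "0 \<le> s l" if "l \<le> k" for l
      using \<phi>pos[OF that] assms(17) \<mu> by (simp add: s_def)
    have "m \<le> 2 * \<tau> / (c * (real k + 1))"
    proof (rule frank_wolfe_gap_rate[where D = D and \<phi> = \<phi>])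
      show "c > 0" using \<mu> assms(17) Rpos by (simp add: c_def)
    next
      fix l assume l: "l \<le> k"
      have "D l \<le> x l \<bullet> (zstar - z l)"
        using dual_fun_add_le[OF cF compX grad(1,2)[OF l l], of "zstar - z l"] by (simp add: D_def)
      also have "\<dots> = x l \<bullet> zstar"
        using grad(3)[OF l l] by (simp add: inner_diff_right)
      also have "\<dots> \<le> \<tau> * \<phi> l"
        unfolding assms(14)
      proof (rule inner_le_gauge_mult)
        show "x l \<bullet> v \<le> \<phi> l" if "v \<in> a ` Y" for v
          using that le_sip_phi[OF compY cG] Ga by (auto simp: \<phi>_def)
      qed (use Y zsK \<phi>pos l in auto)
      finally show "D l \<le> \<tau> * \<phi> l" .
      have "z l \<in> convex_cone hull (a ` Y)"
        using dual[OF l] coneY[OF l] by (auto simp: is_arg_max_linorder)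
      then have "z l + s l *\<^sub>R a (yhat (x l)) \<in> convex_cone hull (a ` Y)"
        using yY[OF l] s0[OF l]
        by (intro convex_cone_hull_add convex_cone_hull_mul) (auto intro: hull_inc)
      from zsmax[OF this] incr[OF l] show "c * (\<phi> l)\<^sup>2 \<le> D l"
        by (simp add: D_def)
    next
      fix l assume l: "l < k"
      have "dual_fun F X (z l + s l *\<^sub>R a (yhat (x l))) \<le> dual_fun F X (z (Suc l))"
        using dual[of "Suc l"] cuts(2)[of l "s l"] s0[of l] l by (auto simp: is_arg_max_linorder)
      then show "D (Suc l) \<le> D l - c * (\<phi> l)\<^sup>2"
        using incr[of l] l by (simp add: D_def)
    qed (use m mpos in auto)
    also have "\<dots> = 2 / (real k + 1) * (\<tau> / c)"
      by simp
    also have "\<dots> \<le> 27 / (8 * (real k + 2)) * (\<tau> / c)"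
      using \<open>k \<ge> 2\<close> \<tau>0 \<mu> by (intro mult_right_mono) (auto simp: c_def field_simps)
    also have "\<dots> = 27 * R\<^sup>2 * \<tau> / (4 * \<mu> * (1 - \<delta>)\<^sup>2) * (1 / (real k + 2))"
      using \<mu> assms(17) by (simp add: c_def divide_simps)
    finally show ?thesis unfolding m_def \<phi>_def .
  qed
qed

end
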